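(* Consider a cake cutting problem for $n$ players. Suppose there exists a partition $A=(A_1,\dots,A_m)$ of the cake in which each piece $A_j$ is demarcated with at most $K$ cuts and is worth $w_{i,j}$ to each player $i$. Then for all $\epsilon>0$, a partition $\tilde A=(\tilde A_1,\dots,\tilde A_m)$ in which each piece $\tilde A_j$ is demarcated with at most $K$ cuts and $|V_i(\tilde A_j)-w_{i,j}|\le\epsilon$ for all $i,j$ can be found with $O(K\cdot n/\epsilon)$ Robertson–Webb (RW) queries. That is, there is an absolute constant $c$ such that for all $n,m,K$, numbers $w_{i,j}$ and $\epsilon>0$ there is an RW protocol (knowing $n,m,K,\epsilon$ and the $w_{i,j}$) that asks at most $cKn/\epsilon$ queries and, on every $n$-player instance for which there exists a partition $A=(A_1,\dots,A_m)$ of the cake with each piece $A_j$ demarcated with at most $K$ cuts and $V_i(A_j)=w_{i,j}$ for all $i,j$, outputs a partition $\tilde A=(\tilde A_1,\dots,\tilde A_m)$ with each piece $\tilde A_j$ demarcated with at most $K$ cuts and $|V_i(\tilde A_j)-w_{i,j}|\le\epsilon$ for all $i,j$.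
   Context: Cake cutting model. The cake is $[0,1]$ and the players are $1,\dots,n$. Player $i$ has a private non-negative integrable value density $v_i$ on $[0,1]$ with $\int_0^1 v_i=1$, and values a measurable set $S$ at $V_i(S)=\int_S v_i(x)\,dx$. A piece is a finite (possibly empty) union of disjoint intervals (shared endpoints are irrelevant). A partition $(A_1,\dots,A_m)$ is a division of $[0,1]$ into $m$ pieces, where $m$ need not equal $n$. The number of cuts demarcating a piece is the minimum number of points that can be used to demarcate it: a connected piece $[a,b]$ is demarcated by two cuts $a,b$; a piece $[a,b]\cup[c,d]$ with $a<b<c<d$ by the four cuts $a,b,c,d$, and so on. RW model. A protocol, not knowing the densities, adaptively asks queries $\mathrm{Cut}_i(\alpha)$, $\alpha\in[0,1]$ (player $i$ returns a point $y$ with $V_i([0,y])=\alpha$, ties resolved deterministically, e.g. leftmost; $y$ becomes a cut point) and $\mathrm{Eval}_i(y)$ for a previously made cut point $y$ (player $i$ returns $V_i([0,y])$). At the end it outputs a partition demarcated by cut points discovered through its queries (the endpoints $0$ and $1$ are always available). *)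

theory Defs
  imports "HOL-Analysis.Analysis"
begin

text \<open>
  The players are the numbers \<open>i < n\<close>, the pieces of a division into \<open>m\<close> pieces are the
  entries \<open>j < m\<close> of a list of sets.
\<close>

definition density :: "(real \<Rightarrow> real) \<Rightarrow> bool" where
  "density f \<longleftrightarrow> (\<forall>x\<in>{0..1}. 0 \<le> f x) \<and> f absolutely_integrable_on {0..1} \<and>
     (LINT x:{0..1}|lebesgue. f x) = 1"

definition worth :: "(real \<Rightarrow> real) \<Rightarrow> real set \<Rightarrow> real" where
  "worth f S = (LINT x:S|lebesgue. f x)"

text \<open>
  Shared endpoints being irrelevant, pieces are normalised to unions of closed intervals of
  positive length.
\<close>

definition piece :: "real set \<Rightarrow> bool" where
  "piece S \<longleftrightarrow> (\<exists>I. finite I \<and> (\<forall>(a, b)\<in>I. 0 \<le> a \<and> a < b \<and> b \<le> 1) \<and>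
     disjoint_family_on (\<lambda>(a, b). {a..b}) I \<and> S = (\<Union>(a, b)\<in>I. {a..b}))"

text \<open>
  The endpoints \<open>0\<close> and \<open>1\<close> of the cake count as cuts when they bound an interval of the piece:
  every connected piece \<open>{a..b}\<close> has exactly two cuts.
\<close>

definition demarcates :: "real set \<Rightarrow> real set \<Rightarrow> bool" where
  "demarcates C S \<longleftrightarrow> finite C \<and>
     (\<exists>I \<subseteq> C \<times> C. (\<forall>(a, b)\<in>I. a < b) \<and> S = (\<Union>(a, b)\<in>I. {a..b}))"

definition num_cuts :: "real set \<Rightarrow> nat" where
  "num_cuts S = (LEAST k. \<exists>C. demarcates C S \<and> card C = k)"

definition cake_partition :: "real set list \<Rightarrow> bool" where
  "cake_partition A \<longleftrightarrow> (\<forall>S\<in>set A. piece S) \<and> \<Union>(set A) = {0..1} \<and>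
     (\<forall>j<length A. \<forall>k<length A. j \<noteq> k \<longrightarrow> interior (A ! j) \<inter> interior (A ! k) = {})"

text \<open>
  \<open>cutpt i \<alpha>\<close> is the answer of player \<open>i\<close> to a cut query. Any deterministic rule for resolving
  ties is allowed (the leftmost point is one of them); a protocol does not know the rule.
\<close>

definition cake_instance :: "nat \<Rightarrow> (nat \<Rightarrow> real \<Rightarrow> real) \<Rightarrow> (nat \<Rightarrow> real \<Rightarrow> real) \<Rightarrow> bool" where
  "cake_instance n v cutpt \<longleftrightarrow> (\<forall>i<n. density (v i) \<and>
     (\<forall>\<alpha>\<in>{0..1}. cutpt i \<alpha> \<in> {0..1} \<and> worth (v i) {0..cutpt i \<alpha>} = \<alpha>))"

text \<open>
  An adaptive protocol is a well-founded decision tree: each query node names a player and the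
  argument of the query and continues with the subtree selected by the answer.
\<close>

datatype protocol =
    Output "real set list"
  | Cut nat real "real \<Rightarrow> protocol"
  | Eval nat real "real \<Rightarrow> protocol"

primrec num_queries :: "(nat \<Rightarrow> real \<Rightarrow> real) \<Rightarrow> (nat \<Rightarrow> real \<Rightarrow> real) \<Rightarrow> protocol \<Rightarrow> nat" where
  "num_queries v cutpt (Output A) = 0"
| "num_queries v cutpt (Cut i \<alpha> f) = Suc (num_queries v cutpt (f (cutpt i \<alpha>)))"
| "num_queries v cutpt (Eval i y f) = Suc (num_queries v cutpt (f (worth (v i) {0..y})))"

primrec outcome :: "(nat \<Rightarrow> real \<Rightarrow> real) \<Rightarrow> (nat \<Rightarrow> real \<Rightarrow> real) \<Rightarrow> protocol \<Rightarrow> real set list" where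
  "outcome v cutpt (Output A) = A"
| "outcome v cutpt (Cut i \<alpha> f) = outcome v cutpt (f (cutpt i \<alpha>))"
| "outcome v cutpt (Eval i y f) = outcome v cutpt (f (worth (v i) {0..y}))"

text \<open>
  The last argument is the set of cut points available so far.
\<close>

primrec legal_run ::
    "nat \<Rightarrow> (nat \<Rightarrow> real \<Rightarrow> real) \<Rightarrow> (nat \<Rightarrow> real \<Rightarrow> real) \<Rightarrow> protocol \<Rightarrow> real set \<Rightarrow> bool" where
  "legal_run n v cutpt (Output A) D \<longleftrightarrow>
     cake_partition A \<and> (\<forall>S\<in>set A. \<exists>C\<subseteq>D. demarcates C S)"
| "legal_run n v cutpt (Cut i \<alpha> f) D \<longleftrightarrow>
     i < n \<and> \<alpha> \<in> {0..1} \<and> legal_run n v cutpt (f (cutpt i \<alpha>)) (insert (cutpt i \<alpha>) D)"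
| "legal_run n v cutpt (Eval i y f) D \<longleftrightarrow>
     i < n \<and> y \<in> D \<and> legal_run n v cutpt (f (worth (v i) {0..y})) D"

definition rw_protocol :: "nat \<Rightarrow> protocol \<Rightarrow> bool" where
  "rw_protocol n P \<longleftrightarrow> (\<forall>v cutpt. cake_instance n v cutpt \<longrightarrow> legal_run n v cutpt P {0, 1})"

end

theory Submission
  imports Defs
begin

text \<open>
  Every player cuts the cake into \<open>N = \<lfloor>K / \<epsilon>\<rfloor> + 1\<close> parts of equal worth; there are no other
  queries. Moving a point \<open>y\<close> down to the nearest available cut point changes no player's worth of
  \<open>[0, y]\<close> by more than \<open>1 / N\<close>, even if the worth before and after the move is measured by two
  different densities with the same answers. A piece with \<open>K\<close> cuts therefore changes by at most
  \<open>K / N \<le> \<epsilon>\<close>, and the rounded copy of the unknown partition is acceptable for all instances that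
  give the observed answers. The protocol outputs any division with this last property, which is
  recognisable from the answers alone.

  The half-open interval between the rounded \<open>a\<close> and \<open>b\<close> contains \<open>x\<close> iff the first available cut
  point beyond \<open>x\<close> lies in \<open>(a, b]\<close>. So rounding is taking a preimage, and a partition is rounded to
  a partition.
\<close>

subsection \<open>Values of intervals\<close>

text \<open>Finite sets are null. This mediates between closed intervals, of which pieces consist,
  and half-open ones, whose worths add up without overlap at the ends.\<close>

lemma worth_cong_finite:
  assumes f: "density f" and S: "S \<in> sets lebesgue" "S \<subseteq> {0..1}"
    and T: "T \<in> sets lebesgue" "T \<subseteq> {0..1}"
    and X: "finite X" "S - X = T - X"
  shows "worth f S = worth f T"
  unfolding worth_def
proof (rule set_integral_cong_set)
  have "set_integrable lebesgue {0..1} f" using f by (simp add: density_def)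
  then have "set_integrable lebesgue S f" "set_integrable lebesgue T f"
    using S T by (auto intro: set_integrable_subset)
  then show "set_borel_measurable lebesgue T f" "set_borel_measurable lebesgue S f"
    unfolding set_integrable_def set_borel_measurable_def by auto
  have "AE x in lebesgue. x \<notin> X"
    by (rule AE_not_in) (simp add: X(1) negligible_finite flip: negligible_iff_null_sets)
  then show "AE x in lebesgue. (x \<in> T) = (x \<in> S)"
    by eventually_elim (use X(2) in blast)
qed

lemma worth_atLeastLessThan:
  assumes f: "density f" and ab: "0 \<le> a" "a \<le> b" "b \<le> 1"
  shows "worth f {a..<b} = worth f {0..b} - worth f {0..a}"
proof -
  have "set_integrable lebesgue {0..1} f" using f by (simp add: density_def)
  then have int: "set_integrable lebesgue {0..<a} f" "set_integrable lebesgue {a..<b} f"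
    using ab by (auto intro!: set_integrable_subset[where A = "{0..1}"])
  have "worth f {0..b} = worth f ({0..<a} \<union> {a..<b})"
    using ab by (intro worth_cong_finite[OF f, where X = "{b}"]) auto
  also have "\<dots> = worth f {0..<a} + worth f {a..<b}"
    unfolding worth_def by (rule set_integral_Un[OF _ int]) auto
  also have "worth f {0..<a} = worth f {0..a}"
    using ab by (intro worth_cong_finite[OF f, where X = "{a}"]) auto
  finally show ?thesis by simp
qed

lemma worth_mono:
  assumes f: "density f" and ab: "0 \<le> a" "a \<le> b" "b \<le> 1"
  shows "worth f {0..a} \<le> worth f {0..b}"
proof -
  have "0 \<le> worth f {a..<b}"
    unfolding worth_def set_lebesgue_integral_def
    using f ab by (intro integral_nonneg_AE) (auto simp: density_def indicator_def)
  then show ?thesis using worth_atLeastLessThan[OF assms] by simp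
qed

lemma worth_0: "density f \<Longrightarrow> worth f {0} = 0"
  using worth_cong_finite[of f "{0}" "{}" "{0}"]
  by (simp add: worth_def set_lebesgue_integral_def)

lemma worth_1: "density f \<Longrightarrow> worth f {0..1} = 1"
  by (simp add: density_def worth_def)

text \<open>Degenerate intervals \<open>p j = q j\<close> are allowed; they occur when rounding collapses an interval.\<close>

lemma worth_Union:
  assumes f: "density f" and J: "finite J" "disjoint_family_on (\<lambda>j. {p j..<q j}) J"
    and pq: "\<And>j. j \<in> J \<Longrightarrow> 0 \<le> p j \<and> p j \<le> q j \<and> q j \<le> 1"
  shows "worth f (\<Union>j\<in>{j \<in> J. p j < q j}. {p j..q j})
    = (\<Sum>j\<in>J. worth f {0..q j} - worth f {0..p j})"
proof -
  have int: "set_integrable lebesgue {0..1} f" using f by (simp add: density_def)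
  have "worth f (\<Union>j\<in>{j \<in> J. p j < q j}. {p j..q j}) = worth f (\<Union>j\<in>J. {p j..<q j})"
  \<comment> \<open>Away from the right endpoints the two unions agree: a degenerate interval is
    empty when half open, and any other one loses only \<open>q j\<close>.\<close>
  proof (rule worth_cong_finite[OF f, where X = "q ` J"])
    show "(\<Union>j\<in>{j \<in> J. p j < q j}. {p j..q j}) \<in> sets lebesgue"
      "(\<Union>j\<in>J. {p j..<q j}) \<in> sets lebesgue"
      using J(1) by (auto intro!: sets.finite_UN)
    show "(\<Union>j\<in>{j \<in> J. p j < q j}. {p j..q j}) \<subseteq> {0..1}" "(\<Union>j\<in>J. {p j..<q j}) \<subseteq> {0..1}"
      using pq by fastforce+
    show "finite (q ` J)" using J(1) by simp
    show "(\<Union>j\<in>{j \<in> J. p j < q j}. {p j..q j}) - q ` J = (\<Union>j\<in>J. {p j..<q j}) - q ` J"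
    proof (intro equalityI subsetI)
      fix x assume "x \<in> (\<Union>j\<in>{j \<in> J. p j < q j}. {p j..q j}) - q ` J"
      then obtain j where "j \<in> J" "p j \<le> x" "x \<le> q j" "x \<notin> q ` J" by auto
      then show "x \<in> (\<Union>j\<in>J. {p j..<q j}) - q ` J" by (auto simp: order_le_less)
    next
      fix x assume "x \<in> (\<Union>j\<in>J. {p j..<q j}) - q ` J"
      then obtain j where "j \<in> J" "p j \<le> x" "x < q j" "x \<notin> q ` J" by auto
      then show "x \<in> (\<Union>j\<in>{j \<in> J. p j < q j}. {p j..q j}) - q ` J"
        by (auto intro!: bexI[of _ j])
    qed
  qed
  also have "\<dots> = (\<Sum>j\<in>J. worth f {p j..<q j})"
    unfolding worth_def
    using pq by (intro set_integral_finite_Union[OF J] set_integrable_subset[OF int]) fastforce+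
  also have "\<dots> = (\<Sum>j\<in>J. worth f {0..q j} - worth f {0..p j})"
    using pq by (intro sum.cong refl worth_atLeastLessThan[OF f]) auto
  finally show ?thesis .
qed

subsection \<open>Normal form of pieces\<close>

text \<open>Disjoint closed intervals have gaps between them, so \<open>I\<close> lists the
  connected components of \<open>S\<close>. Unlike in \<open>piece\<close>, they need not lie in the
  cake.\<close>

definition components :: "(real \<times> real) set \<Rightarrow> real set \<Rightarrow> bool" where
  "components I S \<longleftrightarrow> finite I \<and> (\<forall>(a, b)\<in>I. a < b) \<and>
     disjoint_family_on (\<lambda>(a, b). {a..b}) I \<and> S = (\<Union>(a, b)\<in>I. {a..b})"

text \<open>Among the representations with endpoints in \<open>C\<close>, one with the fewest
  intervals is disjoint: two intervals that meet could be replaced by their union, whose endpoints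
  are again in \<open>C\<close>.\<close>

lemma components_exist:
  assumes "finite C" "I \<subseteq> C \<times> C" "\<forall>(a, b)\<in>I. a < b" "S = (\<Union>(a, b)\<in>I. {a..b})"
  obtains J where "J \<subseteq> C \<times> C" "components J S"
proof -
  let ?P = "\<lambda>I. I \<subseteq> C \<times> C \<and> (\<forall>(a, b)\<in>I. a < b) \<and> S = (\<Union>(a, b)\<in>I. {a..b})"
  define J where "J = (ARG_MIN card J. ?P J)"
  have "?P I" using assms by blast
  then have "?P J \<and> (\<forall>I. ?P I \<longrightarrow> card J \<le> card I)"
    unfolding J_def by (rule arg_min_nat_lemma)
  then have J: "?P J" and minimal: "\<And>I. ?P I \<Longrightarrow> card J \<le> card I" by blast+
  have fin: "finite J" using J assms(1) by (auto intro: finite_subset)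
  have "disjoint_family_on (\<lambda>(a, b). {a..b}) J"
  proof (rule ccontr)
    assume "\<not> ?thesis"
    then obtain a b c d x where p: "(a, b) \<in> J" and q: "(c, d) \<in> J" and ne: "(a, b) \<noteq> (c, d)"
      and x: "a \<le> x" "x \<le> b" "c \<le> x" "x \<le> d"
      unfolding disjoint_family_on_def by fastforce
    define L where "L = J - {(a, b)} - {(c, d)}"
    define I' where "I' = insert (min a c, max b d) L"
    have JL: "J = insert (a, b) (insert (c, d) L)" using p q ne by (auto simp: L_def)
    have un: "{min a c..max b d} = {a..b} \<union> {c..d}" using x by auto
    have "finite L" "(a, b) \<notin> insert (c, d) L" "(c, d) \<notin> L" using fin ne by (auto simp: L_def)
    then have "card J = Suc (Suc (card L))" unfolding JL by simp
    \<comment> \<open>Only an inequality, because the merged interval may already belong to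
      \<open>L\<close>.\<close>
    moreover have "card I' \<le> Suc (card L)" unfolding I'_def by (rule card_insert_le_m1) auto
    ultimately have "card I' < card J" by linarith
    moreover have "?P I'"
    proof (intro conjI)
      have "a \<in> C" "b \<in> C" "c \<in> C" "d \<in> C" using J p q by blast+
      then have "min a c \<in> C" "max b d \<in> C" by (simp_all add: min_def max_def)
      moreover have "L \<subseteq> C \<times> C" using J unfolding L_def by blast
      ultimately show "I' \<subseteq> C \<times> C" unfolding I'_def by blast
      have "\<forall>(a, b)\<in>J. a < b" using J by blast
      then show "\<forall>(a, b)\<in>I'. a < b" unfolding JL I'_def by auto
      have "S = (\<Union>(a, b)\<in>J. {a..b})" using J by blast
      then show "S = (\<Union>(a, b)\<in>I'. {a..b})" unfolding JL I'_def by (simp add: un Un_assoc)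
    qed
    ultimately show False using minimal by fastforce
  qed
  then show ?thesis using J fin by (intro that[of J]) (auto simp: components_def)
qed

lemma components_eqI:
  assumes "components I S" "p \<in> I" "q \<in> I" "x \<in> {fst p..snd p}" "x \<in> {fst q..snd q}"
  shows "p = q"
proof (rule ccontr)
  assume "p \<noteq> q"
  then have "(\<lambda>(a, b). {a..b}) p \<inter> (\<lambda>(a, b). {a..b}) q = {}"
    using assms(1-3) unfolding components_def disjoint_family_on_def by blast
  then show False using assms(4,5) by (auto simp: case_prod_beta)
qed

text \<open>Components share no points, so all their endpoints are different. This converts between
  numbers of cuts and numbers of components.\<close>

lemma card_endpoints:
  assumes "components I S"
  shows "card (fst ` I \<union> snd ` I) = 2 * card I"
proof -
  have lt: "fst p < snd p" if "p \<in> I" for p using assms that by (auto simp: components_def)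
  note eq = components_eqI[OF assms]
  have "fst ` I \<inter> snd ` I = {}"
  proof -
    have False if p: "p \<in> I" and q: "q \<in> I" and e: "fst p = snd q" for p q
      using eq[OF p q, of "fst p"] lt[OF p] lt[OF q] e by auto
    then show ?thesis by blast
  qed
  moreover have "inj_on fst I"
  proof (rule inj_onI)
    fix p q assume "p \<in> I" "q \<in> I" "fst p = fst q"
    then show "p = q" using eq[of p q "fst p"] lt[of p] lt[of q] by auto
  qed
  moreover have "inj_on snd I"
  proof (rule inj_onI)
    fix p q assume "p \<in> I" "q \<in> I" "snd p = snd q"
    then show "p = q" using eq[of p q "snd p"] lt[of p] lt[of q] by auto
  qed
  ultimately show ?thesis
    using assms by (simp add: card_Un_disjoint components_def card_image)
qed

text \<open>Rounding can make two components of a piece touch, so disjointness must be restored by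
  merging.\<close>

lemma pieceI:
  assumes "finite I" "\<forall>(a, b)\<in>I. 0 \<le> a \<and> a < b \<and> b \<le> 1" "S = (\<Union>(a, b)\<in>I. {a..b})"
  shows "piece S"
proof -
  let ?C = "fst ` I \<union> snd ` I"
  have C: "finite ?C" "I \<subseteq> ?C \<times> ?C" "\<forall>(a, b)\<in>I. a < b" using assms(1,2) by force+
  obtain J where J: "J \<subseteq> ?C \<times> ?C" "components J S"
    using components_exist[OF C assms(3)] .
  have "?C \<subseteq> {0..1}" using assms(2) by fastforce
  with J(1) have "J \<subseteq> {0..1} \<times> {0..1}" by blast
  then have "\<forall>(a, b)\<in>J. 0 \<le> a \<and> a < b \<and> b \<le> 1" using J(2) by (auto simp: components_def)
  then show ?thesis
    unfolding piece_def using J(2) unfolding components_def by blast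
qed

lemma num_cuts_le: "demarcates C S \<Longrightarrow> num_cuts S \<le> card C"
  unfolding num_cuts_def by (rule Least_le) auto

text \<open>Take a smallest demarcating set and merge its intervals. The resulting components have
  \<open>2 * card J\<close> different endpoints, all of them in that set.\<close>

lemma piece_components:
  assumes "piece S"
  obtains I where "components I S" "\<forall>(a, b)\<in>I. 0 \<le> a \<and> b \<le> 1" "2 * card I \<le> num_cuts S"
proof -
  have "\<exists>C. demarcates C S"
  proof -
    obtain I where I: "finite I" "\<forall>(a, b)\<in>I. 0 \<le> a \<and> a < b \<and> b \<le> 1" "S = (\<Union>(a, b)\<in>I. {a..b})"
      using assms unfolding piece_def by blast
    have "I \<subseteq> (fst ` I \<union> snd ` I) \<times> (fst ` I \<union> snd ` I)" by force
    then have "demarcates (fst ` I \<union> snd ` I) S"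
      unfolding demarcates_def using I by (intro conjI exI[of _ I]) auto
    then show ?thesis by blast
  qed
  then have "\<exists>k C. demarcates C S \<and> card C = k" by blast
  then have "\<exists>C. demarcates C S \<and> card C = num_cuts S"
    unfolding num_cuts_def by (rule LeastI_ex)
  then obtain C I where C: "finite C" "I \<subseteq> C \<times> C" "\<forall>(a, b)\<in>I. a < b"
    "S = (\<Union>(a, b)\<in>I. {a..b})" "card C = num_cuts S"
    unfolding demarcates_def by blast
  obtain J where J: "J \<subseteq> C \<times> C" "components J S"
    using components_exist[OF C(1-4)] .
  have "2 * card J \<le> card C"
    unfolding card_endpoints[OF J(2), symmetric] using J(1) C(1) by (intro card_mono) auto
  \<comment> \<open>\<open>demarcates\<close> does not confine \<open>C\<close> to the cake, so the
    bounds on the components come from \<open>S\<close>.\<close>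
  moreover have "S \<subseteq> {0..1}" using assms unfolding piece_def by fastforce
  then have "\<forall>(a, b)\<in>J. 0 \<le> a \<and> b \<le> 1"
  proof (clarify)
    fix a b assume ab: "(a, b) \<in> J"
    then have "a < b" using J(2) by (auto simp: components_def)
    then have "a \<in> {a..b}" "b \<in> {a..b}" by simp_all
    moreover have "{a..b} \<subseteq> S" using ab J(2) unfolding components_def by blast
    ultimately have "a \<in> S" "b \<in> S" by blast+
    then show "0 \<le> a \<and> b \<le> 1" using \<open>S \<subseteq> {0..1}\<close> by auto
  qed
  ultimately show ?thesis using that J(2) C(5) by simp
qed

subsection \<open>Rounding to a grid\<close>

definition round_to :: "real set \<Rightarrow> real \<Rightarrow> real" where
  "round_to D y = Max {d \<in> D. d \<le> y}"

definition next_in :: "real set \<Rightarrow> real \<Rightarrow> real" where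
  "next_in D x = Min {d \<in> D. x < d}"

text \<open>Says that the answers in \<open>D\<close> cannot tell \<open>f\<close> from
  \<open>g\<close>. The indices \<open>0\<close> and \<open>N\<close> are left out because the ends
  of the cake have worths 0 and 1 under every density.\<close>

definition common_cuts :: "real set \<Rightarrow> nat \<Rightarrow> (real \<Rightarrow> real) \<Rightarrow> (real \<Rightarrow> real) \<Rightarrow> bool" where
  "common_cuts D N f g \<longleftrightarrow> (\<forall>k. 0 < k \<and> k < N \<longrightarrow>
     (\<exists>y\<in>D. worth f {0..y} = real k / real N \<and> worth g {0..y} = real k / real N))"

locale grid =
  fixes D :: "real set"
  assumes finite_grid: "finite D" and grid_subset: "D \<subseteq> {0..1}"
    and zero_in_grid: "0 \<in> D" and one_in_grid: "1 \<in> D"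
begin

lemma round_to: "0 \<le> y \<Longrightarrow> round_to D y \<in> D \<and> round_to D y \<le> y"
  using Max_in[of "{d \<in> D. d \<le> y}"] finite_grid zero_in_grid
  unfolding round_to_def by fastforce

lemma round_to_ge: "d \<in> D \<Longrightarrow> d \<le> y \<Longrightarrow> d \<le> round_to D y"
  unfolding round_to_def using finite_grid by auto

lemma round_to_bounds: "0 \<le> y \<Longrightarrow> 0 \<le> round_to D y \<and> round_to D y \<le> 1"
  using round_to[of y] grid_subset by auto

lemma round_to_mono: "0 \<le> x \<Longrightarrow> x \<le> y \<Longrightarrow> round_to D x \<le> round_to D y"
  using round_to[of x] round_to_ge by force

lemma next_in: "x < 1 \<Longrightarrow> next_in D x \<in> D \<and> x < next_in D x"
  using Min_in[of "{d \<in> D. x < d}"] finite_grid one_in_grid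
  unfolding next_in_def by fastforce

text \<open>Both sides say that no grid point lies in \<open>{x<..y}\<close>.\<close>

lemma round_to_le_iff:
  assumes "x < 1" "0 \<le> y"
  shows "round_to D y \<le> x \<longleftrightarrow> y < next_in D x"
proof
  assume "round_to D y \<le> x"
  then show "y < next_in D x"
    using next_in[OF assms(1)] round_to_ge[of "next_in D x" y] by force
next
  assume y: "y < next_in D x"
  show "round_to D y \<le> x"
  proof (rule ccontr)
    assume "\<not> ?thesis"
    then have "next_in D x \<le> round_to D y"
      unfolding next_in_def using finite_grid round_to[OF assms(2)] by auto
    then show False using y round_to[OF assms(2)] by linarith
  qed
qed

text \<open>Covering and disjointness of rounded intervals thereby become questions about the single
  point \<open>next_in D x\<close> and the original intervals.\<close>

lemma rounded_interval_iff:
  assumes "x < 1" "0 \<le> a" "0 \<le> b"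
  shows "x \<in> {round_to D a..<round_to D b} \<longleftrightarrow> next_in D x \<in> {a<..b}"
  using round_to_le_iff[of x a] round_to_le_iff[of x b] assms by (auto simp: not_le not_less)

text \<open>Let \<open>c k\<close> be the last of the common cuts that is at most \<open>y\<close>.
  Then \<open>y\<close> and its rounding both lie between \<open>c k\<close> and
  \<open>c (Suc k)\<close>, so both worths lie between \<open>k / N\<close> and
  \<open>Suc k / N\<close>, whichever density measures them.\<close>

lemma cut_error:
  fixes N :: nat
  assumes f: "density f" and g: "density g" and N: "0 < N"
    and cuts: "common_cuts D N f g"
    and y: "0 \<le> y" "y \<le> 1"
  shows "\<bar>worth g {0..round_to D y} - worth f {0..y}\<bar> \<le> 1 / real N"
proof -
  have "\<forall>k. \<exists>c. 0 < k \<and> k < N \<longrightarrow>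
      c \<in> D \<and> worth f {0..c} = real k / real N \<and> worth g {0..c} = real k / real N"
    using cuts unfolding common_cuts_def by blast
  then obtain c where c: "\<And>k. 0 < k \<Longrightarrow> k < N \<Longrightarrow>
      c k \<in> D \<and> worth f {0..c k} = real k / real N \<and> worth g {0..c k} = real k / real N"
    by metis
  define z where "z = round_to D y"
  have z: "0 \<le> z" "z \<le> y" "z \<le> 1" "z \<in> D"
    using round_to[of y] y grid_subset by (auto simp: z_def)
  define k where "k = Max {k. k < N \<and> (k = 0 \<or> c k \<le> y)}"
  have fin: "finite {k. k < N \<and> (k = 0 \<or> c k \<le> y)}" by simp
  have "0 \<in> {k. k < N \<and> (k = 0 \<or> c k \<le> y)}" using N by simp
  then have "k \<in> {k. k < N \<and> (k = 0 \<or> c k \<le> y)}"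
    unfolding k_def by (intro Max_in fin) blast
  then have k: "k < N" "k = 0 \<or> c k \<le> y" by simp_all
  have "real k / real N \<le> worth f {0..y} \<and> real k / real N \<le> worth g {0..z}"
  proof (cases "k = 0")
    case True
    then show ?thesis
      using worth_mono[OF f, of 0 y] worth_mono[OF g, of 0 z] worth_0[OF f] worth_0[OF g] y z by simp
  next
    case False
    then have ck: "c k \<le> y" "c k \<in> D" using k c by auto
    then have "0 \<le> c k" "c k \<le> z" using grid_subset round_to_ge by (auto simp: z_def)
    then show ?thesis
      using worth_mono[OF f, of "c k" y] worth_mono[OF g, of "c k" z] ck y z c[of k] k False by simp
  qed
  moreover have "worth f {0..y} \<le> real (Suc k) / real N \<and> worth g {0..z} \<le> real (Suc k) / real N"
  proof (cases "Suc k = N")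
    case True
    then show ?thesis
      using worth_mono[OF f, of y 1] worth_mono[OF g, of z 1] worth_1[OF f] worth_1[OF g] y z N by simp
  next
    case False
    then have Suc: "Suc k < N" using k by simp
    have "\<not> c (Suc k) \<le> y" using Max_ge[OF fin, of "Suc k"] Suc unfolding k_def[symmetric] by auto
    moreover have "c (Suc k) \<le> 1" using c[of "Suc k"] Suc grid_subset by auto
    ultimately show ?thesis
      using worth_mono[OF f, of y "c (Suc k)"] worth_mono[OF g, of z "c (Suc k)"] y z c[of "Suc k"] Suc
      by simp
  qed
  ultimately show ?thesis by (simp add: z_def[symmetric] add_divide_distrib abs_le_iff)
qed

end

section \<open>Rounding a partition interval by interval\<close>

definition rounded :: "real set \<Rightarrow> (real \<times> real) set \<Rightarrow> real set" where
  "rounded D I = (\<Union>p\<in>{p \<in> I. round_to D (fst p) < round_to D (snd p)}.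
     {round_to D (fst p)..round_to D (snd p)})"

lemma roundedI:
  assumes "p \<in> I" "round_to D (fst p) < round_to D (snd p)"
    and "x \<in> {round_to D (fst p)..round_to D (snd p)}"
  shows "x \<in> rounded D I"
  unfolding rounded_def using assms by blast

locale rounding = grid +
  fixes A :: "real set list" and I :: "nat \<Rightarrow> (real \<times> real) set"
  assumes partition: "cake_partition A"
    and comps: "j < length A \<Longrightarrow> components (I j) (A ! j)"
    and comps_bounds: "j < length A \<Longrightarrow> p \<in> I j \<Longrightarrow> 0 \<le> fst p \<and> snd p \<le> 1"
begin

lemma comp_less: "j < length A \<Longrightarrow> p \<in> I j \<Longrightarrow> fst p < snd p"
  using comps[of j] by (auto simp: components_def)

lemma finite_comps: "j < length A \<Longrightarrow> finite (I j)"
  using comps[of j] by (auto simp: components_def)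

lemma comp_subset: "j < length A \<Longrightarrow> p \<in> I j \<Longrightarrow> {fst p..snd p} \<subseteq> A ! j"
  using comps[of j] by (force simp: components_def)

text \<open>Pick \<open>y\<close> below \<open>d\<close> but beyond every right endpoint that is
  below \<open>d\<close>. The component containing \<open>y\<close> cannot end before
  \<open>d\<close>.\<close>

lemma comps_cover:
  assumes d: "0 < d" "d \<le> 1"
  shows "\<exists>j<length A. \<exists>p\<in>I j. d \<in> {fst p<..snd p}"
proof -
  \<comment> \<open>The extra element 0 makes \<open>E\<close> nonempty and keeps \<open>y\<close>
    inside the cake.\<close>
  define E where "E = insert 0 ((\<Union>j<length A. snd ` I j) \<inter> {..<d})"
  have E: "finite E" "0 \<in> E" unfolding E_def using finite_comps by auto
  then have "Max E \<in> E" by (intro Max_in) auto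
  then have "Max E < d" unfolding E_def using d by auto
  then obtain y where y: "Max E < y" "y < d" using dense by blast
  have "0 \<le> Max E" using E by simp
  then have "y \<in> \<Union>(set A)" using partition y d unfolding cake_partition_def by auto
  then obtain j where j: "j < length A" "y \<in> A ! j" by (auto simp: in_set_conv_nth)
  then obtain p where p: "p \<in> I j" "fst p \<le> y" "y \<le> snd p"
    using comps[of j] by (auto simp: components_def)
  have "d \<le> snd p"
  proof (rule ccontr)
    assume "\<not> ?thesis"
    then have "snd p \<in> E" using p(1) j(1) by (auto simp: E_def)
    then have "snd p \<le> Max E" using E(1) by simp
    then show False using y p by simp
  qed
  then show ?thesis using j(1) p y by (auto intro!: exI[of _ j] bexI[of _ p])
qed

text \<open>Two such intervals overlap in an open interval just left of \<open>d\<close>. Different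
  pieces would then have interiors that meet; within one piece, components are disjoint.\<close>

lemma comps_unique:
  assumes jk: "j < length A" "k < length A" and pq: "p \<in> I j" "q \<in> I k"
    and d: "d \<in> {fst p<..snd p}" "d \<in> {fst q<..snd q}"
  shows "j = k \<and> p = q"
proof -
  have "j = k"
  proof (rule ccontr)
    assume "j \<noteq> k"
    let ?U = "{max (fst p) (fst q)<..<d}"
    have "?U \<subseteq> {fst p..snd p}" "?U \<subseteq> {fst q..snd q}" using d by auto
    then have "?U \<subseteq> A ! j" "?U \<subseteq> A ! k" using comp_subset jk pq by blast+
    then have "?U \<subseteq> interior (A ! j) \<inter> interior (A ! k)" by (simp add: interior_maximal)
    also have "\<dots> = {}" using partition jk \<open>j \<noteq> k\<close> by (simp add: cake_partition_def)
    finally show False using d dense[of "max (fst p) (fst q)" d] by auto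
  qed
  then show ?thesis using components_eqI[OF comps[OF jk(1)], of p q d] pq d by auto
qed

lemma rounded_comp_iff:
  assumes "j < length A" "p \<in> I j" "x < 1"
  shows "x \<in> {round_to D (fst p)..<round_to D (snd p)} \<longleftrightarrow> next_in D x \<in> {fst p<..snd p}"
  using comps_bounds[of j p] comp_less[of j p] assms by (intro rounded_interval_iff) auto

lemma rounded_comp_unique:
  assumes "j < length A" "k < length A" "p \<in> I j" "q \<in> I k"
    and "x \<in> {round_to D (fst p)..<round_to D (snd p)}"
    and "x \<in> {round_to D (fst q)..<round_to D (snd q)}"
  shows "j = k \<and> p = q"
proof -
  have "0 \<le> snd p" using comps_bounds[of j p] comp_less[of j p] assms by auto
  then have "x < 1" using round_to_bounds[of "snd p"] assms(5) by auto
  then show ?thesis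
    using rounded_comp_iff assms comps_unique[of j k p q "next_in D x"] by metis
qed

lemma rounded_comp_bounds:
  assumes "j < length A" "p \<in> I j"
  shows "0 \<le> round_to D (fst p) \<and> round_to D (fst p) \<le> round_to D (snd p) \<and>
    round_to D (snd p) \<le> 1"
  using comps_bounds[OF assms] comp_less[OF assms] round_to_bounds[of "fst p"]
    round_to_bounds[of "snd p"] round_to_mono[of "fst p" "snd p"] by auto

text \<open>The rounded endpoints demarcate the rounded piece, and rounding can only identify
  endpoints. Collapsed intervals are dropped, since demarcated intervals must have positive
  length.\<close>

lemma demarcates_rounded:
  assumes j: "j < length A"
  shows "\<exists>C\<subseteq>D. demarcates C (rounded D (I j)) \<and> card C \<le> 2 * card (I j)"
proof -
  let ?C = "round_to D ` (fst ` I j \<union> snd ` I j)"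
  let ?J = "(\<lambda>p. (round_to D (fst p), round_to D (snd p))) `
    {p \<in> I j. round_to D (fst p) < round_to D (snd p)}"
  have "demarcates ?C (rounded D (I j))"
    unfolding demarcates_def rounded_def using finite_comps[OF j]
    by (intro conjI exI[of _ ?J]) auto
  moreover have "?C \<subseteq> D"
    using round_to comps_bounds[OF j] comp_less[OF j] by force
  moreover have "card ?C \<le> 2 * card (I j)"
    unfolding card_endpoints[OF comps[OF j], symmetric] using finite_comps[OF j]
    by (intro card_image_le) simp
  ultimately show ?thesis by blast
qed

lemma piece_rounded:
  assumes j: "j < length A"
  shows "piece (rounded D (I j))"
  by (rule pieceI[of "(\<lambda>p. (round_to D (fst p), round_to D (snd p))) `
        {p \<in> I j. round_to D (fst p) < round_to D (snd p)}"])
    (use finite_comps[OF j] rounded_comp_bounds[OF j] in \<open>auto simp: rounded_def\<close>)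

lemma rounded_cover:
  assumes x: "0 \<le> x" "x \<le> 1"
  shows "\<exists>j<length A. x \<in> rounded D (I j)"
proof (cases "x = 1")
  case False
  then have x1: "x < 1" using x by simp
  then have "0 < next_in D x" "next_in D x \<le> 1" using next_in[of x] x grid_subset by auto
  then obtain j p where jp: "j < length A" "p \<in> I j" "next_in D x \<in> {fst p<..snd p}"
    using comps_cover by blast
  then have "x \<in> {round_to D (fst p)..<round_to D (snd p)}" using rounded_comp_iff x1 by blast
  then have "x \<in> rounded D (I j)" using jp(2) by (intro roundedI[of p]) auto
  then show ?thesis using jp(1) by blast
next
  \<comment> \<open>No grid point lies beyond 1, so \<open>next_in\<close> is of no use here. The
    component that reaches 1 keeps its right end, because 1 is a grid point, and its left end stays
    below 1.\<close>
  case True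
  obtain j p where jp: "j < length A" "p \<in> I j" "1 \<in> {fst p<..snd p}"
    using comps_cover[of 1] by auto
  then have "round_to D (fst p) < 1" "1 \<le> round_to D (snd p)"
    using round_to[of "fst p"] comps_bounds[of j p] round_to_ge[OF one_in_grid] by auto
  then have "x \<in> rounded D (I j)" using jp(2) True by (intro roundedI[of p]) auto
  then show ?thesis using jp(1) by blast
qed

lemma partition_rounded: "cake_partition (map (\<lambda>j. rounded D (I j)) [0..<length A])"
  unfolding cake_partition_def
proof (intro conjI allI impI)
  let ?B = "map (\<lambda>j. rounded D (I j)) [0..<length A]"
  show "\<forall>S\<in>set ?B. piece S" using piece_rounded by auto
  show "\<Union>(set ?B) = {0..1}"
  proof (intro equalityI subsetI)
    fix x assume "x \<in> \<Union>(set ?B)"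
    then obtain j p where "j < length A" "p \<in> I j"
        "x \<in> {round_to D (fst p)..round_to D (snd p)}"
      by (auto simp: rounded_def)
    then show "x \<in> {0..1}" using rounded_comp_bounds[of j p] by simp
  next
    fix x :: real assume "x \<in> {0..1}"
    then show "x \<in> \<Union>(set ?B)" using rounded_cover[of x] by auto
  qed
  fix j k assume "j < length ?B" "k < length ?B" "j \<noteq> k"
  then have jk: "j < length A" "k < length A" by auto
  let ?U = "interior (?B ! j) \<inter> interior (?B ! k)"
  \<comment> \<open>Rounded intervals of different pieces are disjoint up to right endpoints, which
    are grid points. So the intersection of the interiors is an open subset of a finite set, hence
    empty.\<close>
  have "?U \<subseteq> D"
  proof
    fix x assume "x \<in> ?U"
    then have "x \<in> ?B ! j" "x \<in> ?B ! k" using interior_subset by blast+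
    then have "x \<in> rounded D (I j)" "x \<in> rounded D (I k)" using jk by simp_all
    then obtain p q where pq: "p \<in> I j" "q \<in> I k"
        "x \<in> {round_to D (fst p)..round_to D (snd p)}" "x \<in> {round_to D (fst q)..round_to D (snd q)}"
      unfolding rounded_def by blast
    have "x = round_to D (snd p) \<or> x = round_to D (snd q)"
    proof (rule ccontr)
      assume "\<not> ?thesis"
      then have "x \<in> {round_to D (fst p)..<round_to D (snd p)}"
          "x \<in> {round_to D (fst q)..<round_to D (snd q)}"
        using pq(3,4) by auto
      then show False using rounded_comp_unique[OF jk pq(1,2)] \<open>j \<noteq> k\<close> by blast
    qed
    moreover have "0 \<le> snd p" "0 \<le> snd q"
      using comps_bounds comp_less jk pq(1,2) by (meson less_imp_le order_trans)+
    ultimately show "x \<in> D" using round_to by auto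
  qed
  then have "finite ?U" using finite_grid finite_subset by blast
  then show "?U = {}" using finite_imp_not_open[of ?U] by blast
qed

text \<open>Both worths are signed sums over the \<open>2 * card (I j)\<close> endpoints of the
  components, and \<open>cut_error\<close> bounds the difference at each endpoint by
  \<open>1 / N\<close>.\<close>

lemma worth_rounded:
  fixes N :: nat
  assumes f: "density f" and g: "density g" and N: "0 < N"
    and cuts: "common_cuts D N f g"
    and j: "j < length A"
  shows "\<bar>worth g (rounded D (I j)) - worth f (A ! j)\<bar> \<le> real (2 * card (I j)) / real N"
proof -
  have "A ! j = (\<Union>p\<in>{p \<in> I j. fst p < snd p}. {fst p..snd p})"
    using comps[OF j] comp_less[OF j] by (auto simp: components_def case_prod_beta)
  also have "worth f \<dots> = (\<Sum>p\<in>I j. worth f {0..snd p} - worth f {0..fst p})"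
  proof (rule worth_Union[OF f finite_comps[OF j]])
    show "disjoint_family_on (\<lambda>p. {fst p..<snd p}) (I j)"
      unfolding disjoint_family_on_def
    proof (intro ballI impI, rule ccontr)
      fix p q assume "p \<in> I j" "q \<in> I j" "p \<noteq> q" "{fst p..<snd p} \<inter> {fst q..<snd q} \<noteq> {}"
      moreover then obtain x where "x \<in> {fst p..<snd p}" "x \<in> {fst q..<snd q}" by blast
      ultimately show False using components_eqI[OF comps[OF j], of p q x] by auto
    qed
  qed (use comps_bounds[OF j] comp_less[OF j] in fastforce)
  finally have A: "worth f (A ! j) = (\<Sum>p\<in>I j. worth f {0..snd p} - worth f {0..fst p})" .
  have B: "worth g (rounded D (I j)) =
    (\<Sum>p\<in>I j. worth g {0..round_to D (snd p)} - worth g {0..round_to D (fst p)})"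
    unfolding rounded_def
  proof (rule worth_Union[OF g finite_comps[OF j]])
    show "disjoint_family_on (\<lambda>p. {round_to D (fst p)..<round_to D (snd p)}) (I j)"
      unfolding disjoint_family_on_def using rounded_comp_unique[OF j j] by blast
  qed (rule rounded_comp_bounds[OF j])
  have "\<bar>worth g (rounded D (I j)) - worth f (A ! j)\<bar> \<le> (\<Sum>p\<in>I j. 2 / real N)"
    unfolding A B sum_subtractf[symmetric]
  proof (rule order_trans[OF sum_abs sum_mono])
    fix p assume "p \<in> I j"
    then have "0 \<le> fst p" "fst p < snd p" "snd p \<le> 1" using comps_bounds comp_less j by auto
    then show "\<bar>worth g {0..round_to D (snd p)} - worth g {0..round_to D (fst p)} -
        (worth f {0..snd p} - worth f {0..fst p})\<bar> \<le> 2 / real N"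
      using cut_error[OF f g N cuts, of "fst p"] cut_error[OF f g N cuts, of "snd p"] by auto
  qed
  then show ?thesis by (simp add: mult.commute)
qed

end

text \<open>One \<open>B\<close> serves all pairs of densities, hence all players and all
  indistinguishable instances at once: \<open>f\<close> measures the given partition,
  \<open>g\<close> judges the rounded one.\<close>

lemma partition_on_grid:
  assumes "grid D" and A: "cake_partition A" and K: "\<And>j. j < length A \<Longrightarrow> num_cuts (A ! j) \<le> K"
  obtains B where "cake_partition B" "length B = length A"
    "\<And>j. j < length A \<Longrightarrow> \<exists>C\<subseteq>D. demarcates C (B ! j)"
    "\<And>j. j < length A \<Longrightarrow> num_cuts (B ! j) \<le> K"
    "\<And>f g N j. density f \<Longrightarrow> density g \<Longrightarrow> 0 < N \<Longrightarrow> common_cuts D N f g \<Longrightarrow>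
      j < length A \<Longrightarrow> \<bar>worth g (B ! j) - worth f (A ! j)\<bar> \<le> real K / real N"
proof -
  have "\<exists>I. components I (A ! j) \<and> (\<forall>(a, b)\<in>I. 0 \<le> a \<and> b \<le> 1) \<and> 2 * card I \<le> K"
    if j: "j < length A" for j
  proof -
    have "piece (A ! j)" using A j by (simp add: cake_partition_def)
    then show ?thesis using piece_components K[OF j] by (metis order_trans)
  qed
  then obtain I where I: "\<And>j. j < length A \<Longrightarrow>
      components (I j) (A ! j) \<and> (\<forall>(a, b)\<in>I j. 0 \<le> a \<and> b \<le> 1) \<and> 2 * card (I j) \<le> K"
    by metis
  interpret grid D by fact
  interpret rounding D A I
    by unfold_locales (use A I in \<open>auto simp: case_prod_beta\<close>)
  let ?B = "map (\<lambda>j. rounded D (I j)) [0..<length A]"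
  show thesis
  proof (rule that[of ?B])
    show "cake_partition ?B" by (rule partition_rounded)
    show "length ?B = length A" by simp
    show "\<exists>C\<subseteq>D. demarcates C (?B ! j)" if "j < length A" for j
      using demarcates_rounded[OF that] that by auto
    show "num_cuts (?B ! j) \<le> K" if j: "j < length A" for j
    proof -
      obtain C where "demarcates C (rounded D (I j))" "card C \<le> 2 * card (I j)"
        using demarcates_rounded[OF j] by blast
      then show ?thesis using num_cuts_le I[OF j] j by fastforce
    qed
    show "\<bar>worth g (?B ! j) - worth f (A ! j)\<bar> \<le> real K / real N"
      if "density f" "density g" "0 < N"
        "common_cuts D N f g" "j < length A" for f g N j
    proof -
      have "\<bar>worth g (?B ! j) - worth f (A ! j)\<bar> \<le> real (2 * card (I j)) / N"
        using worth_rounded[OF that] that(5) by simp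
      also have "\<dots> \<le> real K / N" using I[OF that(5)] by (intro divide_right_mono) auto
      finally show ?thesis .
    qed
  qed
qed

subsection \<open>Protocols with a fixed list of cut queries\<close>

primrec ask :: "(nat \<times> real) list \<Rightarrow> (real list \<Rightarrow> real set list) \<Rightarrow> protocol" where
  "ask [] h = Output (h [])"
| "ask (q # qs) h = Cut (fst q) (snd q) (\<lambda>y. ask qs (\<lambda>ys. h (y # ys)))"

definition answers :: "(nat \<Rightarrow> real \<Rightarrow> real) \<Rightarrow> (nat \<times> real) list \<Rightarrow> real list" where
  "answers cutpt qs = map (\<lambda>(i, \<alpha>). cutpt i \<alpha>) qs"

lemma num_queries_ask: "num_queries v cutpt (ask qs h) = length qs"
  by (induction qs arbitrary: h) auto

lemma outcome_ask: "outcome v cutpt (ask qs h) = h (answers cutpt qs)"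
  by (induction qs arbitrary: h) (auto simp: answers_def)

lemma legal_run_ask:
  "legal_run n v cutpt (ask qs h) D \<longleftrightarrow> (\<forall>(i, \<alpha>)\<in>set qs. i < n \<and> \<alpha> \<in> {0..1}) \<and>
     legal_run n v cutpt (Output (h (answers cutpt qs))) (D \<union> set (answers cutpt qs))"
  by (induction qs arbitrary: h D) (auto simp: answers_def case_prod_beta)

text \<open>
  The worth of \<open>X\<close> must be right in every instance that gives the answers \<open>ys\<close>, since the protocol
  cannot tell these instances apart.
\<close>

definition safe_output ::
    "nat \<Rightarrow> nat \<Rightarrow> nat \<Rightarrow> (nat \<Rightarrow> nat \<Rightarrow> real) \<Rightarrow> real \<Rightarrow> (nat \<times> real) list \<Rightarrow> real list \<Rightarrow>
      real set list \<Rightarrow> bool" where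
  "safe_output n m K w \<epsilon> qs ys X \<longleftrightarrow> cake_partition X \<and> length X = m \<and>
     (\<forall>S\<in>set X. \<exists>C\<subseteq>{0, 1} \<union> set ys. demarcates C S) \<and> (\<forall>j<m. num_cuts (X ! j) \<le> K) \<and>
     (\<forall>v cutpt. cake_instance n v cutpt \<and> answers cutpt qs = ys \<longrightarrow>
        (\<forall>i<n. \<forall>j<m. \<bar>worth (v i) (X ! j) - w i j\<bar> \<le> \<epsilon>))"

text \<open>Each player makes only the \<open>N - 1\<close> inner cuts. One more query per player
  would break the bound \<open>K * n / \<epsilon>\<close>, for instance when
  \<open>K = 0\<close>.\<close>

definition equal_cuts :: "nat \<Rightarrow> nat \<Rightarrow> (nat \<times> real) list" where
  "equal_cuts n N = map (\<lambda>(i, k). (i, real k / real N)) (List.product [0..<n] [1..<N])"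

lemma length_equal_cuts: "length (equal_cuts n N) = n * (N - 1)"
  by (simp add: equal_cuts_def)

lemma set_equal_cuts: "set (equal_cuts n N) = {(i, real k / real N) |i k. i < n \<and> 0 < k \<and> k < N}"
  by (force simp: equal_cuts_def)

text \<open>The witness is the partition \<open>A\<close> of the actual instance, rounded to the
  answers. The protocol does not know \<open>A\<close>; its existence suffices.\<close>

lemma safe_output_exists:
  assumes inst: "cake_instance n v cutpt" and N: "0 < N" "real K / real N \<le> \<epsilon>"
    and A: "cake_partition A" "length A = m" "\<And>j. j < m \<Longrightarrow> num_cuts (A ! j) \<le> K"
    and w: "\<And>i j. i < n \<Longrightarrow> j < m \<Longrightarrow> worth (v i) (A ! j) = w i j"
  shows "\<exists>X. safe_output n m K w \<epsilon> (equal_cuts n N) (answers cutpt (equal_cuts n N)) X"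
proof -
  let ?qs = "equal_cuts n N"
  let ?D = "{0, 1} \<union> set (answers cutpt ?qs)"
  have arg: "real k / real N \<in> {0..1}" if "k < N" for k using that by simp
  have grid: "grid ?D"
  proof
    show "?D \<subseteq> {0..1}"
      using inst arg unfolding answers_def set_map set_equal_cuts cake_instance_def by auto
  qed (auto simp: answers_def)
  have K: "num_cuts (A ! j) \<le> K" if "j < length A" for j using A(2,3) that by simp
  obtain B where B: "cake_partition B" "length B = length A"
    "\<And>j. j < length A \<Longrightarrow> \<exists>C\<subseteq>?D. demarcates C (B ! j)"
    "\<And>j. j < length A \<Longrightarrow> num_cuts (B ! j) \<le> K"
    "\<And>f g N j. density f \<Longrightarrow> density g \<Longrightarrow> 0 < N \<Longrightarrow> common_cuts ?D N f g \<Longrightarrow>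
      j < length A \<Longrightarrow> \<bar>worth g (B ! j) - worth f (A ! j)\<bar> \<le> real K / real N"
    using partition_on_grid[OF grid A(1) K] by blast
  have "\<bar>worth (v' i) (B ! j) - w i j\<bar> \<le> \<epsilon>"
    if inst': "cake_instance n v' cutpt'" "answers cutpt' ?qs = answers cutpt ?qs"
      and ij: "i < n" "j < m" for v' cutpt' i j
  proof -
    \<comment> \<open>In both instances the same point answers the query for \<open>k / N\<close>,
      so the actual density \<open>v i\<close> and the hypothetical \<open>v' i\<close> both give it
      worth \<open>k / N\<close>.\<close>
    have "common_cuts ?D N (v i) (v' i)"
      unfolding common_cuts_def
    proof (intro allI impI)
      fix k assume k: "0 < k \<and> k < N"
      then have q: "(i, real k / real N) \<in> set ?qs" using ij by (auto simp: set_equal_cuts)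
      then have eq: "cutpt' i (real k / real N) = cutpt i (real k / real N)"
        using inst'(2) unfolding answers_def by fastforce
      have "cutpt i (real k / real N) \<in> ?D" using q unfolding answers_def by force
      moreover have "worth (v i) {0..cutpt i (real k / real N)} = real k / real N"
        using inst ij(1) arg[of k] k unfolding cake_instance_def by blast
      moreover have "worth (v' i) {0..cutpt i (real k / real N)} = real k / real N"
        using inst'(1) ij(1) arg[of k] k unfolding cake_instance_def eq[symmetric] by blast
      ultimately show "\<exists>y\<in>?D. worth (v i) {0..y} = real k / real N \<and>
          worth (v' i) {0..y} = real k / real N" by blast
    qed
    then have "\<bar>worth (v' i) (B ! j) - worth (v i) (A ! j)\<bar> \<le> real K / real N"
      using inst inst'(1) ij A(2) N(1) by (intro B(5)) (auto simp: cake_instance_def)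
    then show ?thesis using w ij N(2) by simp
  qed
  then have "safe_output n m K w \<epsilon> ?qs (answers cutpt ?qs) B"
    using B(1-4) A(2) unfolding safe_output_def by (auto simp: in_set_conv_nth)
  then show ?thesis by blast
qed

text \<open>The fallback output: a protocol must end legally on every instance, even if no partition
  has the worths \<open>w\<close>. Its cuts 0 and 1 are always available.\<close>

lemma trivial_partition: "cake_partition [{0..1}]" "demarcates {0, 1} {0..1}"
proof -
  show "cake_partition [{0..1}]"
    by (auto simp: cake_partition_def intro!: pieceI[of "{(0, 1)}"])
  show "demarcates {0, 1} {0..1}"
    unfolding demarcates_def by (intro conjI exI[of _ "{(0, 1)}"]) auto
qed

section \<open>The equal-cuts protocol and its guarantee\<close>

theorem lemma1:
  "\<exists>c::real. \<forall>(n::nat) (m::nat) (K::nat) (w::nat \<Rightarrow> nat \<Rightarrow> real) (\<epsilon>::real). \<epsilon> > 0 \<longrightarrow>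
     (\<exists>P. rw_protocol n P \<and>
       (\<forall>v cutpt. cake_instance n v cutpt \<longrightarrow>
          real (num_queries v cutpt P) \<le> c * real K * real n / \<epsilon> \<and>
          ((\<exists>A. cake_partition A \<and> length A = m \<and>
                (\<forall>j<m. num_cuts (A ! j) \<le> K) \<and>
                (\<forall>i<n. \<forall>j<m. worth (v i) (A ! j) = w i j)) \<longrightarrow>
           cake_partition (outcome v cutpt P) \<and> length (outcome v cutpt P) = m \<and>
           (\<forall>j<m. num_cuts (outcome v cutpt P ! j) \<le> K) \<and>
           (\<forall>i<n. \<forall>j<m. \<bar>worth (v i) (outcome v cutpt P ! j) - w i j\<bar> \<le> \<epsilon>))))"
proof (intro exI[of _ 1] allI impI)
  fix n m K :: nat and w :: "nat \<Rightarrow> nat \<Rightarrow> real" and \<epsilon> :: real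
  assume \<epsilon>: "\<epsilon> > 0"
  \<comment> \<open>This gives \<open>N - 1 \<le> K / \<epsilon> < N\<close>: the left half bounds
    the \<open>n * (N - 1)\<close> queries with constant 1, the right half bounds the error. The
    successor keeps \<open>N\<close> positive when \<open>K = 0\<close>.\<close>
  define N where "N = Suc (nat \<lfloor>real K / \<epsilon>\<rfloor>)"
  have "real K / \<epsilon> \<ge> 0" using \<epsilon> by simp
  then have N: "real (N - 1) \<le> real K / \<epsilon>" "real K / \<epsilon> < real N"
    unfolding N_def by linarith+
  then have "real K \<le> \<epsilon> * real N" using \<epsilon> by (simp add: field_simps)
  then have err: "real K / real N \<le> \<epsilon>" unfolding N_def by (subst pos_divide_le_eq) auto
  define qs where "qs = equal_cuts n N"
  let ?safe = "safe_output n m K w \<epsilon> qs"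
  \<comment> \<open>\<open>safe_output\<close> refers to the answers but to no particular instance,
    so choosing a safe output is a legitimate output rule.\<close>
  define h where "h ys = (if \<exists>X. ?safe ys X then SOME X. ?safe ys X else [{0..1}])" for ys
  have safe_h: "?safe ys (h ys)" if "?safe ys X" for ys X
  proof -
    have ex: "\<exists>X. ?safe ys X" using that by blast
    then have "h ys = (SOME X. ?safe ys X)" by (simp add: h_def)
    then show ?thesis using someI_ex[OF ex] by simp
  qed
  show "\<exists>P. rw_protocol n P \<and>
       (\<forall>v cutpt. cake_instance n v cutpt \<longrightarrow>
          real (num_queries v cutpt P) \<le> 1 * real K * real n / \<epsilon> \<and>
          ((\<exists>A. cake_partition A \<and> length A = m \<and>
                (\<forall>j<m. num_cuts (A ! j) \<le> K) \<and>
                (\<forall>i<n. \<forall>j<m. worth (v i) (A ! j) = w i j)) \<longrightarrow>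
           cake_partition (outcome v cutpt P) \<and> length (outcome v cutpt P) = m \<and>
           (\<forall>j<m. num_cuts (outcome v cutpt P ! j) \<le> K) \<and>
           (\<forall>i<n. \<forall>j<m. \<bar>worth (v i) (outcome v cutpt P ! j) - w i j\<bar> \<le> \<epsilon>)))"
  proof (intro exI[of _ "ask qs h"] conjI allI impI)
    have "\<forall>(i, \<alpha>)\<in>set qs. i < n \<and> \<alpha> \<in> {0..1}" by (auto simp: qs_def set_equal_cuts)
    moreover have "cake_partition (h ys) \<and> (\<forall>S\<in>set (h ys). \<exists>C\<subseteq>{0, 1} \<union> set ys. demarcates C S)" for ys
    proof (cases "\<exists>X. ?safe ys X")
      case True
      then show ?thesis using safe_h unfolding safe_output_def by blast
    next
      case False
      then have "h ys = [{0..1}]" by (simp add: h_def)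
      moreover have "\<exists>C\<subseteq>{0, 1} \<union> set ys. demarcates C {0..1}"
        by (rule exI[of _ "{0, 1}"]) (use trivial_partition(2) in simp)
      ultimately show ?thesis using trivial_partition(1) by simp
    qed
    ultimately show "rw_protocol n (ask qs h)"
      unfolding rw_protocol_def legal_run_ask by simp
  next
    fix v cutpt
    have "real (n * (N - 1)) \<le> real n * (real K / \<epsilon>)"
      unfolding of_nat_mult using N(1) by (intro mult_left_mono) auto
    then show "real (num_queries v cutpt (ask qs h)) \<le> 1 * real K * real n / \<epsilon>"
      by (simp add: num_queries_ask qs_def length_equal_cuts mult.commute)
  next
    fix v cutpt
    assume inst: "cake_instance n v cutpt"
      and "\<exists>A. cake_partition A \<and> length A = m \<and> (\<forall>j<m. num_cuts (A ! j) \<le> K) \<and>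
        (\<forall>i<n. \<forall>j<m. worth (v i) (A ! j) = w i j)"
    then obtain X where "?safe (answers cutpt qs) X"
      using safe_output_exists[OF inst _ err] unfolding qs_def N_def by blast
    then have safe: "?safe (answers cutpt qs) (outcome v cutpt (ask qs h))"
      unfolding outcome_ask by (rule safe_h)
    then show "cake_partition (outcome v cutpt (ask qs h))" "length (outcome v cutpt (ask qs h)) = m"
      unfolding safe_output_def by auto
    fix j assume j: "j < m"
    then show "num_cuts (outcome v cutpt (ask qs h) ! j) \<le> K"
      using safe unfolding safe_output_def by auto
    show "\<bar>worth (v i) (outcome v cutpt (ask qs h) ! j) - w i j\<bar> \<le> \<epsilon>" if "i < n" for i
      \<comment> \<open>The actual instance is one of those that give the observed answers.\<close>
      using safe inst j that unfolding safe_output_def by blast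
  qed
qed

end
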